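(* Let $p\in(0,1)$. Consider the version of the two-player card game "Beggar My Neighbour" in which the player who starts each round is determined by a Bernoulli trial with parameter $p$, and in which the trick is shuffled when it is returned to the winner's deck. Then the mathematical expectation of the number of moves required for the game to end is finite.
   Context: **Deck.** There is a finite set $W$ of cards. Each card is either an ordinary card or a picture card, and a picture card is a jack, a queen, a king or an ace. The penalty of a picture card is $1$ for a jack, $2$ for a queen, $3$ for a king, $4$ for an ace. At the start the deck is divided between the two players. Each player keeps his cards as an ordered deck and may only take the top card of it. The statement is understood for every initial deal. **Round.** The starting player puts his top card on the table. Then the players alternately put their top cards on the table, one at a time, until a picture card is put down. When a player $X$ puts down a picture card with penalty $k$, the other player $Y$ must pay a penalty by putting down $k$ of his cards, one by one from the top of his deck. If during this payment $Y$ puts down a picture card, the payment stops, and $X$ must now start paying the penalty of that new picture card by the same rule, and so on. If a penalty is paid in full with no picture card among the paid cards, the round is over. The player to whom the penalty was paid takes all the cards on the table (the trick), and these are placed, in uniformly random order (independent of everything else), at the bottom of his deck. **Starting player.** In the modified game considered here, the player starting each round is player 1 with probability $p$ and player 2 with probability $1-p$, independently for different rounds and of the shuffles. (In the classical game the player who took the trick starts the next round and the trick is not shuffled.) **End of the game.** A player left without cards after a round loses and the game ends. If a player cannot make a move prescribed by the rules (he must put down a card but has none), so that the round cannot be completed, he loses and the game ends. **Number of moves.** This is the number of rounds played until the game ends. (Each round consists of at most $|W|$ card placements, so counting card placements instead does not affect finiteness of the expectation.) *)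

theory Defs
  imports "HOL-Probability.Probability" "HOL-Combinatorics.Multiset_Permutations"
begin

datatype rank = Ordinary | Jack | Queen | King | Ace

fun penalty :: "rank \<Rightarrow> nat" where
  "penalty Ordinary = 0"
| "penalty Jack = 1"
| "penalty Queen = 2"
| "penalty King = 3"
| "penalty Ace = 4"

datatype player = Player1 | Player2

fun opponent :: "player \<Rightarrow> player" where
  "opponent Player1 = Player2"
| "opponent Player2 = Player1"

text \<open>The head of a deck is its top card.\<close>

type_synonym 'c decks = "player \<Rightarrow> 'c list"

definition deal :: "'c set \<Rightarrow> 'c decks \<Rightarrow> bool" where
  "deal W d \<longleftrightarrow> distinct (d Player1 @ d Player2) \<and> set (d Player1 @ d Player2) = W"

text \<open>
  A round either cannot be completed, because the given player has to put down a card but has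
  none, or it is completed: then the outcome consists of the player who takes the trick, the decks
  before the trick is returned, and the cards of the trick.
\<close>

datatype 'c outcome = Stuck player | Taken player "'c decks" "'c list"

text \<open>
  The deterministic part of a round. In \<open>play rk q due d t\<close> it is player \<open>q\<close>'s turn and the cards
  \<open>t\<close> are on the table. If \<open>due = None\<close>, no picture card has been put down yet and the players
  alternate; if \<open>due = Some k\<close>, player \<open>q\<close> still owes \<open>k\<close> cards of the current penalty to his
  opponent.
\<close>

function play :: "('c \<Rightarrow> rank) \<Rightarrow> player \<Rightarrow> nat option \<Rightarrow> 'c decks \<Rightarrow> 'c list \<Rightarrow> 'c outcome" where
  "play rk q due d t =
    (if due = Some 0 then Taken (opponent q) d t
     else case d q of
       [] \<Rightarrow> Stuck q
     | c # cs \<Rightarrow>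
         if rk c = Ordinary then
           (case due of
              None \<Rightarrow> play rk (opponent q) None (d(q := cs)) (c # t)
            | Some k \<Rightarrow> play rk q (Some (k - 1)) (d(q := cs)) (c # t))
         else play rk (opponent q) (Some (penalty (rk c))) (d(q := cs)) (c # t))"
  by pat_completeness auto
termination
proof (relation "Wellfounded.measure (\<lambda>(rk, q, due, d, t). length (d Player1) + length (d Player2))", goal_cases)
  case (2 rk q due d t c cs)
  then show ?case by (cases q) auto
next
  case (3 rk q due d t c cs k)
  then show ?case by (cases q) auto
next
  case (4 rk q due d t c cs)
  then show ?case by (cases q) auto
qed auto

declare play.simps [simp del]

datatype 'c position = Playing "'c decks" | Lost player

fun after_round :: "'c outcome \<Rightarrow> 'c position pmf" where
  "after_round (Stuck q) = return_pmf (Lost q)"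
| "after_round (Taken w d t) =
     map_pmf (\<lambda>u. let d' = d(w := d w @ u) in
                   if d' (opponent w) = [] then Lost (opponent w) else Playing d')
             (pmf_of_set (permutations_of_multiset (mset t)))"

fun next_position :: "real \<Rightarrow> ('c \<Rightarrow> rank) \<Rightarrow> 'c position \<Rightarrow> 'c position pmf" where
  "next_position p rk (Playing d) =
     bernoulli_pmf p \<bind>
       (\<lambda>b. after_round (play rk (if b then Player1 else Player2) None d []))"
| "next_position p rk (Lost q) = return_pmf (Lost q)"

text \<open>
  The law of the sequence of positions (before the first round, after the first round, and so on)
  is the measure on infinite sequences given by the Ionescu-Tulcea theorem for the kernels
  \<open>game_kernel\<close>.  Lemma \<open>emeasure_game\<close> below describes it explicitly.
\<close>

definition game_kernel ::
    "real \<Rightarrow> ('c \<Rightarrow> rank) \<Rightarrow> 'c decks \<Rightarrow> nat \<Rightarrow> (nat \<Rightarrow> 'c position) \<Rightarrow> 'c position measure" where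
  "game_kernel p rk d n \<omega> =
     measure_pmf (case n of 0 \<Rightarrow> return_pmf (Playing d) | Suc m \<Rightarrow> next_position p rk (\<omega> m))"

definition game ::
    "real \<Rightarrow> ('c \<Rightarrow> rank) \<Rightarrow> 'c decks \<Rightarrow> (nat \<Rightarrow> 'c position) measure" where
  "game p rk d =
     projective_family.lim UNIV
       (Ionescu_Tulcea.CI (game_kernel p rk d) (\<lambda>_. count_space UNIV)) (\<lambda>_. count_space UNIV)"

text \<open>
  Positions \<open>Lost q\<close> are absorbing, so this is the number of rounds played, where a final round
  that cannot be completed is counted; it is \<open>\<infinity>\<close> if the game never ends.
\<close>

definition num_rounds :: "(nat \<Rightarrow> 'c position) \<Rightarrow> enat" where
  "num_rounds \<omega> = (INF n \<in> {n. \<exists>q. \<omega> n = Lost q}. enat n)"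

lemma Ionescu_Tulcea_game: "Ionescu_Tulcea (game_kernel p rk d) (\<lambda>_. count_space UNIV)"
proof (rule Ionescu_Tulcea.intro)
  fix i :: nat
  show "game_kernel p rk d i \<in>
          measurable (PiM {0..<i} (\<lambda>_. count_space UNIV)) (subprob_algebra (count_space UNIV))"
  proof (cases i)
    case (Suc m)
    have "(\<lambda>\<omega>. \<omega> m) \<in> measurable (PiM {0..<i} (\<lambda>_. count_space UNIV)) (count_space UNIV)"
      using Suc by (intro measurable_component_singleton) auto
    moreover have "(\<lambda>s. measure_pmf (next_position p rk s)) \<in>
        measurable (count_space UNIV) (subprob_algebra (count_space UNIV))"
      by (simp add: measure_pmf_in_subprob_algebra)
    ultimately show ?thesis
      unfolding game_kernel_def Suc nat.case by (rule measurable_compose)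
  next
    case 0
    have "game_kernel p rk d i = (\<lambda>_. measure_pmf (return_pmf (Playing d)))"
      by (simp add: game_kernel_def fun_eq_iff 0)
    then show ?thesis
      by (simp add: measure_pmf_in_subprob_algebra)
  qed
next
  fix i x
  show "prob_space (game_kernel p rk d i x)"
    by (simp add: game_kernel_def measure_pmf.prob_space_axioms)
qed

lemma space_game [simp]: "space (game p rk d) = UNIV"
proof -
  interpret Ionescu_Tulcea "game_kernel p rk d" "\<lambda>_. count_space UNIV"
    by (rule Ionescu_Tulcea_game)
  show ?thesis
    by (simp add: game_def space_PiM)
qed

lemma sets_game [measurable_cong]: "sets (game p rk d) = sets (PiM UNIV (\<lambda>_. count_space UNIV))"
proof -
  interpret Ionescu_Tulcea "game_kernel p rk d" "\<lambda>_. count_space UNIV"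
    by (rule Ionescu_Tulcea_game)
  show ?thesis
    by (simp add: game_def)
qed

lemma prob_space_game: "prob_space (game p rk d)"
proof -
  interpret Ionescu_Tulcea "game_kernel p rk d" "\<lambda>_. count_space UNIV"
    by (rule Ionescu_Tulcea_game)
  have "emeasure PF.lim (PF.emb UNIV {} {\<lambda>_. undefined}) = emeasure (CI {}) {\<lambda>_. undefined}"
    by (rule lim) (auto simp: PiM_empty)
  moreover have "PF.emb UNIV {} {\<lambda>_. undefined} = UNIV"
    by (auto simp: prod_emb_def space_PiM restrict_def)
  moreover have "emeasure (CI {}) {\<lambda>_. undefined} = 1"
  proof -
    interpret P: prob_space "CI {}"
      by (rule PF.prob_space_P) auto
    show ?thesis
      using P.emeasure_space_1 by (simp add: CI_def space_PiM)
  qed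
  ultimately show ?thesis
    by (intro prob_spaceI) (simp add: game_def space_PiM)
qed

lemma emeasure_game:
  "emeasure (game p rk d) {\<omega>. \<forall>i\<le>n. \<omega> i = s i} =
     (if s 0 = Playing d then \<Prod>i<n. ennreal (pmf (next_position p rk (s i)) (s (Suc i))) else 0)"
proof -
  interpret Ionescu_Tulcea "game_kernel p rk d" "\<lambda>_. count_space UNIV"
    by (rule Ionescu_Tulcea_game)
  let ?M = "\<lambda>n. PiM {0..<n} (\<lambda>_::nat. count_space (UNIV :: 'a position set))"
  let ?x = "\<lambda>_::nat. undefined :: 'a position"
  let ?A = "\<lambda>n. {restrict s {0..<n}}"
  have A: "?A n \<in> sets (?M n)" for n
  proof -
    have "?A n = PiE {0..<n} (\<lambda>i. {restrict s {0..<n} i})"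
      by (rule PiE_singleton[symmetric]) simp
    also have "\<dots> \<in> sets (?M n)"
      by (intro sets_PiM_I_finite) auto
    finally show ?thesis .
  qed
  have x: "?x \<in> space (?M 0)"
    by (simp add: space_PiM)
  have step: "emeasure (C 0 (Suc n) ?x) (?A (Suc n)) =
      emeasure (game_kernel p rk d n (restrict s {0..<n})) {s n} * emeasure (C 0 n ?x) (?A n)" for n
  proof -
    have "emeasure (C 0 (Suc n) ?x) (?A (Suc n)) =
        (\<integral>\<^sup>+\<omega>. emeasure (eP n \<omega>) (?A (Suc n)) \<partial>C 0 n ?x)"
    proof -
      have "space (C 0 n ?x) \<noteq> {}"
        by (rule prob_space.not_empty[OF prob_space_C[OF x]])
      moreover have "eP n \<in> measurable (C 0 n ?x) (subprob_algebra (?M (Suc n)))"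
        using measurable_eP[of n] sets_C[OF x, of n]
        by (simp cong: measurable_cong_sets)
      ultimately show ?thesis
        using A[of "Suc n"] by (simp add: emeasure_bind[where N="?M (Suc n)"])
    qed
    also have "\<dots> = (\<integral>\<^sup>+\<omega>. emeasure (game_kernel p rk d n (restrict s {0..<n})) {s n} *
        indicator (?A n) \<omega> \<partial>C 0 n ?x)"
    proof (rule nn_integral_cong)
      fix \<omega> assume "\<omega> \<in> space (C 0 n ?x)"
      then have \<omega>: "\<omega> \<in> space (?M n)"
        by (simp add: space_C x)
      then have ext: "\<omega> \<in> extensional {0..<n}"
        by (simp add: space_PiM PiE_def)
      have "fun_upd \<omega> n y = restrict s {0..<Suc n} \<longleftrightarrow> \<omega> = restrict s {0..<n} \<and> y = s n" for y
      proof
        assume *: "fun_upd \<omega> n y = restrict s {0..<Suc n}"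
        have "\<omega> i = restrict s {0..<n} i" for i
          using fun_cong[OF *, of i] ext by (cases "i < n") (auto simp: extensional_def)
        then show "\<omega> = restrict s {0..<n} \<and> y = s n"
          using fun_cong[OF *, of n] by auto
      qed (auto simp: fun_eq_iff)
      then have "(\<lambda>y. fun_upd \<omega> n y) -` ?A (Suc n) =
          (if \<omega> = restrict s {0..<n} then {s n} else {})"
        by (simp add: vimage_def)
      then show "emeasure (eP n \<omega>) (?A (Suc n)) =
          emeasure (game_kernel p rk d n (restrict s {0..<n})) {s n} * indicator (?A n) \<omega>"
        by (subst emeasure_eP[OF \<omega> A]) auto
    qed
    also have "\<dots> = emeasure (game_kernel p rk d n (restrict s {0..<n})) {s n} *
        emeasure (C 0 n ?x) (?A n)"
      by (rule nn_integral_cmult_indicator) (use A[of n] in \<open>simp add: sets_C[OF x]\<close>)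
    finally show ?thesis .
  qed
  have zero: "emeasure (C 0 0 ?x) (?A 0) = 1"
    using A[of 0] by (simp add: restrict_def)
  have main: "emeasure (C 0 (Suc n) ?x) (?A (Suc n)) =
    (if s 0 = Playing d then \<Prod>i<n. ennreal (pmf (next_position p rk (s i)) (s (Suc i))) else 0)"
  proof (induction n)
    case 0
    show ?case
      unfolding step zero
      by (auto simp: game_kernel_def emeasure_pmf_single)
  next
    case (Suc n)
    have "emeasure (game_kernel p rk d (Suc n) (restrict s {0..<Suc n})) {s (Suc n)} =
        ennreal (pmf (next_position p rk (s n)) (s (Suc n)))"
      by (simp add: game_kernel_def emeasure_pmf_single)
    then show ?case
      unfolding step[of "Suc n"] Suc by (simp add: mult.commute)
  qed
  have "emeasure (game p rk d) {\<omega>. \<forall>i\<le>n. \<omega> i = s i} =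
      emeasure PF.lim (PF.emb UNIV {0..<Suc n} (?A (Suc n)))"
    unfolding game_def
  proof (rule arg_cong[where f="emeasure PF.lim"], intro set_eqI iffI)
    fix \<omega> assume "\<omega> \<in> PF.emb UNIV {0..<Suc n} (?A (Suc n))"
    then have *: "restrict \<omega> {0..<Suc n} = restrict s {0..<Suc n}"
      by (simp add: prod_emb_def)
    have "\<omega> i = s i" if "i \<le> n" for i
      using fun_cong[OF *, of i] that by auto
    then show "\<omega> \<in> {\<omega>. \<forall>i\<le>n. \<omega> i = s i}"
      by simp
  qed (auto simp: prod_emb_def space_PiM restrict_def fun_eq_iff)
  also have "\<dots> = emeasure (CI {0..<Suc n}) (?A (Suc n))"
    by (rule lim) (use A in auto)
  also have "\<dots> = emeasure (C 0 (Suc n) ?x) (PF.emb {0..<Suc n} {0..<Suc n} (?A (Suc n)))"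
    by (rule emeasure_CI) (use A in auto)
  also have "PF.emb {0..<Suc n} {0..<Suc n} (?A (Suc n)) = ?A (Suc n)"
    by (rule prod_emb_id) (auto simp: space_PiM)
  finally show ?thesis
    using main by simp
qed

lemma measurable_num_rounds [measurable]:
  "num_rounds \<in> measurable (game p rk d) (count_space UNIV)"
proof -
  have eq: "num_rounds \<omega> = (INF n. if \<exists>q. \<omega> n = Lost q then enat n else \<infinity>)"
    for \<omega> :: "nat \<Rightarrow> 'a position"
    unfolding num_rounds_def
  proof (intro antisym INF_greatest, goal_cases)
    case (1 n)
    then show ?case by (auto intro: INF_lower)
  next
    case (2 n)
    then show ?case by (intro INF_lower2[of n]) auto
  qed
  have "(\<lambda>\<omega>. \<omega> n) \<in> measurable (game p rk d) (count_space UNIV)" for n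
    unfolding measurable_cong_sets[OF sets_game refl]
    by (rule measurable_component_singleton) simp
  then have "(\<lambda>\<omega>. if \<exists>q. \<omega> n = Lost q then enat n else \<infinity>) \<in>
      measurable (game p rk d) (count_space UNIV)" for n
    by (rule measurable_compose) simp
  then show ?thesis
    unfolding eq[abs_def] by measurable
qed

end

theory Submission
  imports Defs
begin

text \<open>
  Suppose that the set \<open>C\<close> of deals from which the game almost surely never ends is not empty. The
  chain cannot leave \<open>C\<close>, whichever player starts and however the trick is shuffled; consider the
  shuffle that returns the trick in the reverse order of play. The cards of a trick, in the order in
  which they were put down, are then read off the winner's deck from the bottom, and the trick ends
  where the rules say so. Hence the map sending a deal and a starting player to the
  winner of the trick and the next deal is injective. It maps \<open>C \<times> UNIV\<close> to \<open>UNIV \<times> C\<close>, so by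
  finiteness every deal in \<open>C\<close> has a predecessor in \<open>C\<close> from which player 1 takes the trick. But
  in such a round player 2 loses a card, so a deal of \<open>C\<close> in which player 2 has as many cards as
  possible has no such predecessor. Thus the game can end from every deal, and the probability
  that it is still going on decays geometrically.
\<close>

section \<open>Rounds as sequences of cards put down\<close>

lemma opponent_opponent [simp]: "opponent (opponent q) = q"
  by (cases q) auto

lemma opponent_neq [simp]: "opponent q \<noteq> q" "q \<noteq> opponent q"
  by (cases q; simp)+

lemma opponent_eq_iff [simp]: "opponent q = opponent r \<longleftrightarrow> q = r"
  by (metis opponent_opponent)

lemma player_cases: "q = w \<or> q = opponent w"
  by (cases q; cases w) auto

text \<open>Together with \<open>next_due\<close> this merges the recursive calls of
  \<open>play\<close> into one transition, so that inductions over a round have a single case for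
  putting down a card.\<close>

definition next_turn :: "('c \<Rightarrow> rank) \<Rightarrow> player \<Rightarrow> nat option \<Rightarrow> 'c \<Rightarrow> player" where
  "next_turn rk q due c = (if rk c = Ordinary \<and> due \<noteq> None then q else opponent q)"

definition next_due :: "('c \<Rightarrow> rank) \<Rightarrow> nat option \<Rightarrow> 'c \<Rightarrow> nat option" where
  "next_due rk due c =
     (if rk c = Ordinary then map_option (\<lambda>k. k - 1) due else Some (penalty (rk c)))"

text \<open>
  In \<open>trick rk q due d cs w e\<close>, the list \<open>cs\<close> consists of the cards still to be put down,
  in the order of play.
\<close>

inductive trick :: "('c \<Rightarrow> rank) \<Rightarrow> player \<Rightarrow> nat option \<Rightarrow> 'c decks \<Rightarrow> 'c list \<Rightarrow> player \<Rightarrow>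
    'c decks \<Rightarrow> bool" for rk where
  paid: "trick rk q (Some 0) d [] (opponent q) d"
| put: "due \<noteq> Some 0 \<Longrightarrow> d q = c # ds \<Longrightarrow>
    trick rk (next_turn rk q due c) (next_due rk due c) (d(q := ds)) cs w e \<Longrightarrow>
    trick rk q due d (c # cs) w e"

lemma trick_paid_iff: "trick rk q (Some 0) d cs w e \<longleftrightarrow> cs = [] \<and> w = opponent q \<and> e = d"
  by (subst trick.simps) auto

lemma trick_put_cases:
  assumes "trick rk q due d cs w e" "due \<noteq> Some 0"
  obtains c ds cs' where "cs = c # cs'" "d q = c # ds"
    "trick rk (next_turn rk q due c) (next_due rk due c) (d(q := ds)) cs' w e"
  using assms(1) by (rule trick.cases) (use assms(2) that in blast)+

lemma play_paid: "play rk q (Some 0) d t = Taken (opponent q) d t"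
  by (subst play.simps) simp

lemma play_stuck: "due \<noteq> Some 0 \<Longrightarrow> d q = [] \<Longrightarrow> play rk q due d t = Stuck q"
  by (subst play.simps) simp

lemma play_put:
  "due \<noteq> Some 0 \<Longrightarrow> d q = c # ds \<Longrightarrow>
    play rk q due d t = play rk (next_turn rk q due c) (next_due rk due c) (d(q := ds)) (c # t)"
  by (subst play.simps) (auto simp: next_turn_def next_due_def split: option.split)

text \<open>\<open>play\<close> piles the cards onto the head of its list, hence the reversal. The
  induction is on the number of cards still in the decks.\<close>

lemma trick_if_play:
  "play rk q due d t = Taken w e u \<Longrightarrow> \<exists>cs. u = rev cs @ t \<and> trick rk q due d cs w e"
proof (induction "length (d Player1) + length (d Player2)" arbitrary: q due d t
    rule: less_induct)
  case less
  show ?case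
  proof (cases "due = Some 0")
    case True
    with less.prems show ?thesis
      by (auto simp: play_paid intro: trick.paid)
  next
    case False
    with less.prems obtain c ds where ds: "d q = c # ds"
      by (cases "d q") (auto simp: play_stuck)
    have "\<exists>cs. u = rev cs @ (c # t) \<and>
        trick rk (next_turn rk q due c) (next_due rk due c) (d(q := ds)) cs w e"
    proof (rule less.hyps)
      show "length ((d(q := ds)) Player1) + length ((d(q := ds)) Player2) <
          length (d Player1) + length (d Player2)"
        using ds by (cases q) auto
      show "play rk (next_turn rk q due c) (next_due rk due c) (d(q := ds)) (c # t) = Taken w e u"
        using less.prems play_put[of due d q c ds rk t] False ds by simp
    qed
    then obtain cs where "u = rev cs @ (c # t)"
      "trick rk (next_turn rk q due c) (next_due rk due c) (d(q := ds)) cs w e"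
      by blast
    with False ds show ?thesis
      by (intro exI[of _ "c # cs"]) (auto intro: trick.put)
  qed
qed

lemma mset_trick:
  "trick rk q due d cs w e \<Longrightarrow>
    mset (d Player1 @ d Player2) = mset (e Player1 @ e Player2) + mset cs"
proof (induction rule: trick.induct)
  case (put due d q c ds cs w e)
  then show ?case by (cases q) auto
qed auto

lemma length_trick_le:
  "trick rk q due d cs w e \<Longrightarrow> length (e x) \<le> length (d x)"
proof (induction rule: trick.induct)
  case (put due d q c ds cs w e)
  then show ?case by (cases "x = q") auto
qed auto

lemma penalty_eq_0_iff: "penalty r = 0 \<longleftrightarrow> r = Ordinary"
  by (cases r) auto

text \<open>The last card of a trick is paid by its loser.\<close>

lemma length_trick_less:
  "trick rk q due d cs w e \<Longrightarrow> due \<noteq> Some 0 \<Longrightarrow>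
    length (e (opponent w)) < length (d (opponent w))"
proof (induction rule: trick.induct)
  case (put due d q c ds cs w e)
  show ?case
  proof (cases "next_due rk due c = Some 0")
    case True
    \<comment> \<open>Picture cards have positive penalty and \<open>None\<close> never turns into
      \<open>Some 0\<close> by an ordinary card, so \<open>q\<close> has just paid an ordinary card
      and keeps the turn.\<close>
    then have "next_turn rk q due c = q"
      by (auto simp: next_due_def next_turn_def penalty_eq_0_iff split: if_splits)
    with put.hyps(3) True have "w = opponent q" "e = d(q := ds)"
      by (simp_all add: trick_paid_iff)
    with put.hyps(2) show ?thesis by simp
  next
    case False
    with put.IH have "length (e (opponent w)) < length ((d(q := ds)) (opponent w))"
      by simp
    also have "\<dots> \<le> length (d (opponent w))"
      using put.hyps(2) by simp
    finally show ?thesis .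
  qed
qed auto

text \<open>
  When a trick ends is determined by the cards put down, so no trick is a proper initial segment of
  another one. Hence the trick can be read off the winner's deck from the bottom.
\<close>

lemma trick_inject:
  "trick rk q due d cs w e \<Longrightarrow> trick rk q' due d' cs' w e' \<Longrightarrow>
    cs @ rev (e w) = cs' @ rev (e' w) \<Longrightarrow> e (opponent w) = e' (opponent w) \<Longrightarrow>
    q = q' \<and> d = d'"
proof (induction arbitrary: q' d' cs' rule: trick.induct)
  case (paid q d)
  \<comment> \<open>The common \<open>due\<close> is \<open>Some 0\<close>, so the second trick is
    empty too.\<close>
  from paid.prems(1) have "cs' = []" "q' = q" "d' = e'"
    by (simp_all add: trick_paid_iff)
  with paid.prems have "d x = d' x" for x
    using player_cases[of x q] by auto
  with \<open>q' = q\<close> show ?case by auto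
next
  case (put due d q c ds cs w e)
  obtain c' ds' cs'' where *: "cs' = c' # cs''" "d' q' = c' # ds'"
    "trick rk (next_turn rk q' due c') (next_due rk due c') (d'(q' := ds')) cs'' w e'"
    by (rule trick_put_cases[OF put.prems(1) put.hyps(1)])
  \<comment> \<open>Both sequences start with the card put down, so \<open>c' = c\<close> and the
    two plays keep a common \<open>next_due\<close>, as the induction hypothesis requires.\<close>
  with put.prems have c: "c' = c" and cs: "cs @ rev (e w) = cs'' @ rev (e' w)"
    by auto
  have eq: "next_turn rk q due c = next_turn rk q' due c" "d(q := ds) = d'(q' := ds')"
    using put.IH[OF *(3)[unfolded c] cs put.prems(3)] by blast+
  \<comment> \<open>For fixed \<open>due\<close> and card, \<open>next_turn\<close> is the identity
    or \<open>opponent\<close>, hence injective in the player.\<close>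
  from eq(1) have "q = q'"
    by (auto simp: next_turn_def split: if_splits)
  moreover from this eq(2) put.hyps(2) *(2) c have "d x = d' x" for x
    by (cases "x = q") (auto dest: fun_cong[of _ _ x])
  ultimately show ?case by auto
qed

section \<open>No closed class of deals\<close>

lemma UNIV_player: "(UNIV :: player set) = {Player1, Player2}"
  using player.exhaust by auto

text \<open>The assumption \<open>closed\<close> speaks of just one shuffle, the one leaving the
  trick as \<open>play\<close> piled it up; the counting argument is carried out for this
  shuffle.\<close>

lemma no_closed_class:
  fixes C :: "'c decks set"
  assumes "finite C" "C \<noteq> {}"
    and closed: "\<And>d q. d \<in> C \<Longrightarrow>
      \<exists>w e t. play rk q None d [] = Taken w e t \<and> e(w := e w @ t) \<in> C"
  shows False
proof -
  \<comment> \<open>\<open>Stuck\<close> is left unspecified; \<open>closed\<close> rules it out on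
    \<open>C\<close>.\<close>
  define F where "F = (\<lambda>(d, q). case play rk q None d [] of Taken w e t \<Rightarrow> (w, e(w := e w @ t)))"
  have F: "\<exists>w e cs. F (d, q) = (w, e(w := e w @ rev cs)) \<and> trick rk q None d cs w e \<and>
      e(w := e w @ rev cs) \<in> C" if d: "d \<in> C" for d q
  proof -
    obtain w e t where *: "play rk q None d [] = Taken w e t" "e(w := e w @ t) \<in> C"
      using closed[OF d] by blast
    with trick_if_play[OF *(1)] show ?thesis
      by (auto simp: F_def)
  qed
  have "inj_on F (C \<times> UNIV)"
  proof (rule inj_onI, clarify)
    fix d q d' q' assume "d \<in> C" "d' \<in> C" and eq: "F (d, q) = F (d', q')"
    obtain w e cs where 1: "F (d, q) = (w, e(w := e w @ rev cs))" "trick rk q None d cs w e"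
      using F[OF \<open>d \<in> C\<close>] by blast
    obtain w' e' cs' where 2: "F (d', q') = (w', e'(w' := e' w' @ rev cs'))"
      "trick rk q' None d' cs' w' e'"
      using F[OF \<open>d' \<in> C\<close>] by blast
    from eq 1 2 have w: "w' = w" and upd: "e(w := e w @ rev cs) = e'(w := e' w @ rev cs')"
      by auto
    \<comment> \<open>Reading the winner's deck from the bottom gives the form compared in
      \<open>trick_inject\<close>.\<close>
    from fun_cong[OF upd, of w] have "rev (cs @ rev (e w)) = rev (cs' @ rev (e' w))"
      by simp
    then have "cs @ rev (e w) = cs' @ rev (e' w)"
      by (simp only: rev_is_rev_conv)
    moreover from fun_cong[OF upd, of "opponent w"] have "e (opponent w) = e' (opponent w)"
      by simp
    ultimately show "d = d' \<and> q = q'"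
      using trick_inject[OF 1(2) 2(2)[unfolded w]] by simp
  qed
  moreover have "F ` (C \<times> UNIV) \<subseteq> UNIV \<times> C"
  proof
    fix x assume "x \<in> F ` (C \<times> UNIV)"
    then obtain d q where "d \<in> C" "x = F (d, q)" by auto
    with F[OF \<open>d \<in> C\<close>, of q] show "x \<in> UNIV \<times> C"
      by auto
  qed
  moreover have fin: "finite (UNIV \<times> C :: (player \<times> 'c decks) set)"
    using \<open>finite C\<close> by (simp add: UNIV_player)
  \<comment> \<open>Domain and target have the same finite cardinality, so injectivity gives
    surjectivity.\<close>
  ultimately have surj: "F ` (C \<times> UNIV) = UNIV \<times> C"
    by (intro card_subset_eq) (auto simp: card_image card_cartesian_product)
  define l where "l d = length (d Player2)" for d :: "'c decks"
  obtain d where "d \<in> C" and max: "\<And>d'. d' \<in> C \<Longrightarrow> l d' \<le> l d"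
    using Max_in[of "l ` C"] Max_ge[of "l ` C"] assms(1,2) by fastforce
  then have "(Player1, d) \<in> F ` (C \<times> UNIV)"
    using surj by simp
  then obtain d' q where d': "d' \<in> C" "F (d', q) = (Player1, d)"
    by (elim imageE SigmaE) simp
  with F[OF d'(1), of q] obtain e cs where "trick rk q None d' cs Player1 e"
    "d = e(Player1 := e Player1 @ rev cs)"
    by auto
  \<comment> \<open>Player 1 took the trick, so player 2 has the same deck in \<open>d\<close> as in
    \<open>e\<close>, and a longer one in \<open>d'\<close>.\<close>
  with length_trick_less[of rk q None d' cs Player1 e] have "l d < l d'"
    by (simp add: l_def)
  with max[OF d'(1)] show False by simp
qed

section \<open>Finiteness and support of one round\<close>

lemma finite_deals:
  assumes "finite W"
  shows "finite {d. deal W d}"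
proof -
  let ?L = "{xs. set xs \<subseteq> W \<and> length xs \<le> card W}"
  have "{d. deal W d} \<subseteq> (\<lambda>(xs, ys). case_player xs ys) ` (?L \<times> ?L)"
  proof
    fix d assume "d \<in> {d. deal W d}"
    then have d: "distinct (d Player1 @ d Player2)" "set (d Player1 @ d Player2) = W"
      by (auto simp: deal_def)
    have "d = case_player (d Player1) (d Player2)"
      by (rule ext) (simp split: player.split)
    moreover have "length (d Player1 @ d Player2) = card W"
      using d distinct_card by metis
    then have "d Player1 \<in> ?L" "d Player2 \<in> ?L"
      using d by auto
    ultimately show "d \<in> (\<lambda>(xs, ys). case_player xs ys) ` (?L \<times> ?L)"
      by (intro image_eqI[of _ _ "(d Player1, d Player2)"]) auto
  qed
  with finite_lists_length_le[OF assms] show ?thesis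
    by (meson finite_SigmaI finite_imageI finite_subset)
qed

lemma deal_mset_cong:
  "deal W d \<Longrightarrow> mset (d' Player1 @ d' Player2) = mset (d Player1 @ d Player2) \<Longrightarrow> deal W d'"
  unfolding deal_def by (metis mset_eq_imp_distinct_iff mset_eq_setD)

lemma deal_return_trick:
  assumes "deal W d" "play rk q None d [] = Taken w e t" "mset u = mset t"
  shows "deal W (e(w := e w @ u))"
proof -
  obtain cs where "t = rev cs" "trick rk q None d cs w e"
    using trick_if_play[OF assms(2)] by auto
  with mset_trick[of rk q None d cs w e] assms(3) show ?thesis
    by (intro deal_mset_cong[OF assms(1)]) (cases w; simp)
qed

lemma set_pmf_after_round_Taken:
  "set_pmf (after_round (Taken w d t)) =
    (\<lambda>u. let d' = d(w := d w @ u) in if d' (opponent w) = [] then Lost (opponent w) else Playing d') `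
      permutations_of_multiset (mset t)"
  by (simp add: set_pmf_of_set)

text \<open>A trick is a finite list and has finitely many shuffles. This later turns one-step
  integrals into finite sums.\<close>

lemma finite_set_pmf_next_position: "finite (set_pmf (next_position p rk s))"
proof -
  have "finite (set_pmf (after_round x))" for x :: "'c outcome"
    by (cases x) (simp_all add: set_pmf_after_round_Taken del: after_round.simps(2))
  then show ?thesis
    by (cases s) (auto intro: finite_subset[OF subset_UNIV])
qed

lemma next_position_deal:
  assumes "deal W d" "Playing d' \<in> set_pmf (next_position p rk (Playing d))"
  shows "deal W d'"
proof -
  obtain q where q: "Playing d' \<in> set_pmf (after_round (play rk q None d []))"
    using assms(2) by auto
  show ?thesis
  proof (cases "play rk q None d []")
    case (Taken w e t)
    with q obtain u where "mset u = mset t" "d' = e(w := e w @ u)"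
      by (auto simp: set_pmf_after_round_Taken Let_def permutations_of_multiset_def
          simp del: after_round.simps(2) split: if_splits)
    with deal_return_trick[OF assms(1) Taken] show ?thesis by simp
  qed (use q in auto)
qed

text \<open>As \<open>0 < p < 1\<close> and the shuffle is uniform, either starter combined with the
  shuffle leaving \<open>t\<close> unchanged has positive probability. Closure under the support
  therefore gives the closure in \<open>no_closed_class\<close>.\<close>

lemma no_closed_class_next_position:
  assumes "0 < p" "p < 1" "finite C" "C \<noteq> {}"
    and closed: "\<And>d s. d \<in> C \<Longrightarrow> s \<in> set_pmf (next_position p rk (Playing d)) \<Longrightarrow>
      s \<in> Playing ` C"
  shows False
proof (rule no_closed_class[OF assms(3,4)])
  fix d q assume d: "d \<in> C"
  have into_C: "s \<in> Playing ` C" if "s \<in> set_pmf (after_round (play rk q None d []))" for s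
  proof (rule closed[OF d])
    obtain b where b: "q = (if b then Player1 else Player2)"
      by (cases q) (metis (full_types))+
    show "s \<in> set_pmf (next_position p rk (Playing d))"
      unfolding next_position.simps set_bind_pmf set_pmf_bernoulli[OF assms(1,2)]
      using that unfolding b by blast
  qed
  show "\<exists>w e t. play rk q None d [] = Taken w e t \<and> e(w := e w @ t) \<in> C"
  proof (cases "play rk q None d []")
    case (Stuck r)
    with into_C show ?thesis by auto
  next
    case (Taken w e t)
    have "t \<in> permutations_of_multiset (mset t)"
      by (simp add: permutations_of_multiset_def)
    then have "(let d' = e(w := e w @ t) in if d' (opponent w) = [] then Lost (opponent w)
        else Playing d') \<in> Playing ` C"
      using into_C unfolding Taken set_pmf_after_round_Taken by blast
    with Taken show ?thesis
      by (auto simp: Let_def split: if_splits)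
  qed
qed

section \<open>Decay of survival probabilities\<close>

text \<open>Backward recursion on the first step, independent of the measure on sequences. When the
  complement of \<open>A\<close> is absorbing, this is the probability of having stayed in
  \<open>A\<close> up to time \<open>n\<close>.\<close>

fun n_step_prob :: "('a \<Rightarrow> 'a pmf) \<Rightarrow> 'a set \<Rightarrow> nat \<Rightarrow> 'a \<Rightarrow> ennreal" where
  "n_step_prob K A 0 s = indicator A s"
| "n_step_prob K A (Suc n) s = (\<integral>\<^sup>+y. n_step_prob K A n y \<partial>K s)"

lemma nn_integral_pmf_le:
  "(\<And>y. y \<in> set_pmf M \<Longrightarrow> f y \<le> g y) \<Longrightarrow> (\<integral>\<^sup>+y. f y \<partial>measure_pmf M) \<le> (\<integral>\<^sup>+y. g y \<partial>measure_pmf M)"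
  by (intro nn_integral_mono_AE) (simp add: AE_measure_pmf_iff)

lemma n_step_prob_le_1: "n_step_prob K A n s \<le> 1"
proof (induction n arbitrary: s)
  case 0
  show ?case by (simp add: indicator_def)
next
  case (Suc n)
  have "(\<integral>\<^sup>+y. n_step_prob K A n y \<partial>K s) \<le> (\<integral>\<^sup>+y. 1 \<partial>K s)"
    by (intro nn_integral_mono Suc)
  then show ?case by simp
qed

lemma n_step_prob_absorbing:
  "s \<notin> A \<Longrightarrow> (\<And>s. s \<notin> A \<Longrightarrow> K s = return_pmf s) \<Longrightarrow> n_step_prob K A n s = 0"
  by (induction n) auto

text \<open>A chain that has left \<open>A\<close> never returns; this gives the first step, and
  monotonicity of the integral carries it on.\<close>

lemma n_step_prob_antimono:
  assumes "\<And>s. s \<notin> A \<Longrightarrow> K s = return_pmf s" "m \<le> n"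
  shows "n_step_prob K A n s \<le> n_step_prob K A m s"
proof -
  have step: "n_step_prob K A (Suc n) s \<le> n_step_prob K A n s" for n s
  proof (induction n arbitrary: s)
    case 0
    show ?case
    proof (cases "s \<in> A")
      case True
      with n_step_prob_le_1[of K A "Suc 0" s] show ?thesis
        by (simp del: n_step_prob.simps(2))
    next
      case False
      with n_step_prob_absorbing[of s A K "Suc 0"] assms(1) show ?thesis
        by (metis zero_le)
    qed
  next
    case (Suc n)
    then show ?case
      by (subst (1 2) n_step_prob.simps) (intro nn_integral_mono)
  qed
  show ?thesis
    by (rule lift_Suc_antimono_le[of "\<lambda>n. n_step_prob K A n s"]) (use step assms(2) in auto)
qed

text \<open>An average of numbers at most 1 equals 1 only if all those of positive weight are
  1.\<close>

lemma n_step_prob_eq_1_step: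
  assumes "n_step_prob K A (Suc n) s = 1" "y \<in> set_pmf (K s)"
  shows "n_step_prob K A n y = 1"
proof -
  have "(\<integral>\<^sup>+y. 1 - n_step_prob K A n y \<partial>K s) = (\<integral>\<^sup>+y. 1 \<partial>K s) - (\<integral>\<^sup>+y. n_step_prob K A n y \<partial>K s)"
    using assms(1) by (intro nn_integral_diff) (auto simp: n_step_prob_le_1)
  also have "\<dots> = 0"
    using assms(1) by simp
  finally have "1 - n_step_prob K A n y = 0"
    using assms(2) by (simp add: nn_integral_0_iff_AE AE_measure_pmf_iff)
  then show ?thesis
    using n_step_prob_le_1[of K A n y] by (metis diff_eq_0_iff_ennreal ennreal_one_less_top
        antisym le_less_linear less_le)
qed

text \<open>Markov property: a chain surviving \<open>n\<close> steps is then in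
  \<open>S \<inter> A\<close>, from where it survives \<open>m\<close> more with probability at most
  \<open>c\<close>.\<close>

lemma n_step_prob_add_le:
  assumes S: "\<And>s y. s \<in> S \<Longrightarrow> y \<in> set_pmf (K s) \<Longrightarrow> y \<in> S"
    and "\<And>s. s \<in> S \<inter> A \<Longrightarrow> n_step_prob K A m s \<le> c"
    and "\<And>s. s \<notin> A \<Longrightarrow> K s = return_pmf s"
    and "s \<in> S"
  shows "n_step_prob K A (n + m) s \<le> c * n_step_prob K A n s"
  using \<open>s \<in> S\<close>
proof (induction n arbitrary: s)
  case 0
  with assms(2,3) show ?case
    by (cases "s \<in> A") (auto simp: n_step_prob_absorbing)
next
  case (Suc n)
  have "n_step_prob K A (Suc n + m) s \<le> (\<integral>\<^sup>+y. c * n_step_prob K A n y \<partial>K s)"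
    using Suc S by (auto intro!: nn_integral_pmf_le)
  also have "\<dots> = c * n_step_prob K A (Suc n) s"
    by (simp add: nn_integral_cmult)
  finally show ?case .
qed

text \<open>Peeling off the first \<open>m\<close> terms bounds each partial sum by \<open>m\<close>
  plus \<open>c\<close> times itself.\<close>

lemma ennreal_suminf_less_top:
  fixes f :: "nat \<Rightarrow> ennreal"
  assumes "\<And>n. f n \<le> 1" "\<And>n. f (n + m) \<le> c * f n" "c < 1"
  shows "(\<Sum>n. f n) < \<infinity>"
proof -
  \<comment> \<open>Passing to reals allows solving this inequality for the partial sum.\<close>
  define g where "g n = enn2real (f n)" for n
  have f: "f n = ennreal (g n)" for n
    using assms(1)[of n] unfolding g_def
    by (metis ennreal_enn2real ennreal_one_less_top le_less_trans)
  obtain c' where c: "c = ennreal c'" "0 \<le> c'" "c' < 1"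
    using \<open>c < 1\<close> by (cases c) auto
  have g0: "0 \<le> g n" for n
    by (simp add: g_def)
  have g1: "g n \<le> 1" for n
    using assms(1)[of n] by (simp add: f)
  have gm: "g (n + m) \<le> c' * g n" for n
    using assms(2)[of n] c g0 by (simp add: f ennreal_mult[symmetric])
  have "(\<Sum>n<N. g n) \<le> m / (1 - c')" for N
  proof -
    have "(\<Sum>n<N. g n) \<le> (\<Sum>n<N + m. g n)"
      by (intro sum_mono2) (auto simp: g0)
    also have "\<dots> = (\<Sum>n<m. g n) + (\<Sum>n<N. g (n + m))"
      by (induction N) simp_all
    also have "\<dots> \<le> (\<Sum>n<m. 1) + (\<Sum>n<N. c' * g n)"
      by (intro add_mono sum_mono g1 gm)
    finally have "(1 - c') * (\<Sum>n<N. g n) \<le> m"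
      by (simp add: sum_distrib_left[symmetric] algebra_simps)
    with \<open>c' < 1\<close> show ?thesis
      by (simp add: field_simps)
  qed
  then have "(\<Sum>n<N. f n) \<le> ennreal (m / (1 - c'))" for N
    by (auto simp: f sum_ennreal g0 intro!: ennreal_leI)
  then have "(\<Sum>n. f n) \<le> ennreal (m / (1 - c'))"
    using ennreal_suminf_bound_add[of f 0] by simp
  then show ?thesis
    using ennreal_less_top le_less_trans unfolding infinity_ennreal_def by blast
qed

text \<open>Finiteness of \<open>S\<close> makes the escape time and the bound below 1 uniform, so
  survival decays geometrically.\<close>

lemma n_step_prob_summable:
  assumes "finite S" "s \<in> S"
    and S: "\<And>s y. s \<in> S \<Longrightarrow> y \<in> set_pmf (K s) \<Longrightarrow> y \<in> S"
    and A: "\<And>s. s \<notin> A \<Longrightarrow> K s = return_pmf s"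
    and leave: "\<And>s. s \<in> S \<inter> A \<Longrightarrow> \<exists>n. n_step_prob K A n s < 1"
  shows "(\<Sum>n. n_step_prob K A n s) < \<infinity>"
proof -
  obtain N where N: "\<And>s. s \<in> S \<inter> A \<Longrightarrow> n_step_prob K A (N s) s < 1"
    using leave by metis
  \<comment> \<open>The inserted 0 keeps \<open>Max\<close> meaningful when
    \<open>S \<inter> A\<close> is empty.\<close>
  define m where "m = Max (insert 0 (N ` (S \<inter> A)))"
  define c where "c = Max (insert 0 (n_step_prob K A m ` (S \<inter> A)))"
  have "n_step_prob K A m s < 1" if "s \<in> S \<inter> A" for s
  proof -
    have "N s \<le> m"
      unfolding m_def using that \<open>finite S\<close> by (intro Max_ge) auto
    with N[OF that] n_step_prob_antimono[OF A] show ?thesis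
      by (meson le_less_trans)
  qed
  then have "c < 1"
    unfolding c_def using \<open>finite S\<close> by (subst Max_less_iff) auto
  moreover have "n_step_prob K A m s \<le> c" if "s \<in> S \<inter> A" for s
    unfolding c_def using that \<open>finite S\<close> by (intro Max_ge) auto
  then have "n_step_prob K A (n + m) s \<le> c * n_step_prob K A n s" for n
    using S A \<open>s \<in> S\<close> by (intro n_step_prob_add_le) auto
  ultimately show ?thesis
    by (intro ennreal_suminf_less_top[of _ m c]) (auto simp: n_step_prob_le_1)
qed

section \<open>From one-step kernels to the measure on sequences\<close>

lemma measurable_game_component [measurable]:
  "(\<lambda>\<omega>. \<omega> n) \<in> measurable (game p rk d) (count_space UNIV)"
  unfolding measurable_cong_sets[OF sets_game refl]
  by (rule measurable_component_singleton) simp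

lemma sets_game_component [measurable]:
  "{\<omega>. P (\<omega> n)} \<in> sets (game p rk d)"
  using measurable_sets[OF measurable_game_component[of n p rk d], of "Collect P"]
  by (simp add: vimage_def)

lemma sets_game_prefix: "{\<omega>. \<forall>i\<le>n. \<omega> i = s i} \<in> sets (game p rk d)"
proof -
  have "{\<omega>. \<forall>i\<le>n. \<omega> i = s i} = (\<Inter>i\<in>{..n}. {\<omega>. \<omega> i = s i})"
    by auto
  then show ?thesis
    by (simp only:) (intro sets.finite_INT sets_game_component[where P="\<lambda>x. x = s _"]; simp)
qed

text \<open>The induction lengthens the prefix by one position ranging over the finite support;
  \<open>emeasure_game\<close> supplies the factor for that position.\<close>

lemma emeasure_game_prefix_le:
  "emeasure (game p rk d) {\<omega>. (\<forall>i\<le>m. \<omega> i = s i) \<and> \<omega> (m + n) \<in> A} \<le>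
    emeasure (game p rk d) {\<omega>. \<forall>i\<le>m. \<omega> i = s i} * n_step_prob (next_position p rk) A n (s m)"
    (is "emeasure ?G (?E m n s) \<le> emeasure _ (?B m s) * _")
proof (induction n arbitrary: m s)
  case 0
  show ?case
  proof (cases "s m \<in> A")
    case True
    then show ?thesis
      by (auto intro!: emeasure_mono sets_game_prefix)
  next
    case False
    then have "?E m 0 s = {}" by auto
    then show ?thesis by (simp only: emeasure_empty zero_le)
  qed
next
  case (Suc n)
  interpret prob_space ?G by (rule prob_space_game)
  let ?K = "next_position p rk (s m)"
  define u where "u y = s(Suc m := y)" for y
  have u_Suc: "u y (Suc m) = y" and u_le: "i \<le> m \<Longrightarrow> u y i = s i" for y i
    by (simp_all add: u_def)
  let ?F = "set_pmf ?K"
  have fin: "finite ?F"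
    by (rule finite_set_pmf_next_position)
  have B_Suc: "emeasure ?G (?B (Suc m) (u y)) = emeasure ?G (?B m s) * pmf ?K y" for y
    by (simp add: emeasure_game u_Suc u_le)
  have Es: "?E m k s \<in> sets ?G" for m k s
  proof -
    have "?E m k s = ?B m s \<inter> {\<omega>. \<omega> (m + k) \<in> A}" by auto
    then show ?thesis
      by (simp only:) (intro sets.Int sets_game_prefix sets_game_component)
  qed
  let ?U = "\<Union>y\<in>?F. ?B (Suc m) (u y)"
  have Us: "?U \<in> sets ?G"
    using fin sets_game_prefix by (intro sets.finite_UN) auto
  have "emeasure ?G ?U = (\<Sum>y\<in>?F. emeasure ?G (?B (Suc m) (u y)))"
    using fin sets_game_prefix
    by (intro sum_emeasure[symmetric]) (auto simp: disjoint_family_on_def u_Suc)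
  also have "\<dots> = emeasure ?G (?B m s) * (\<Sum>y\<in>?F. ennreal (pmf ?K y))"
    by (simp only: B_Suc sum_distrib_left)
  also have "(\<Sum>y\<in>?F. ennreal (pmf ?K y)) = 1"
    using fin by (simp add: sum_ennreal sum_pmf_eq_1)
  finally have U: "emeasure ?G ?U = emeasure ?G (?B m s)" by simp
  have EUs: "(\<Union>y\<in>?F. ?E (Suc m) n (u y)) \<in> sets ?G"
    by (intro sets.finite_UN fin Es)
  have BUs: "?B m s - ?U \<in> sets ?G"
    by (intro sets.Diff sets_game_prefix Us)
  have "?U \<subseteq> ?B m s"
    by (auto simp: u_le)
  \<comment> \<open>Positions outside the support may be uncountably many, so the remainder is shown
    null by comparing total measures, not by a union.\<close>
  then have null: "emeasure ?G (?B m s - ?U) = 0"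
    using U sets_game_prefix Us by (subst emeasure_Diff) auto
  have "?E m (Suc n) s \<subseteq> (\<Union>y\<in>?F. ?E (Suc m) n (u y)) \<union> (?B m s - ?U)"
    by (auto simp: le_Suc_eq u_le u_Suc)
  then have "emeasure ?G (?E m (Suc n) s) \<le>
      emeasure ?G ((\<Union>y\<in>?F. ?E (Suc m) n (u y)) \<union> (?B m s - ?U))"
    by (intro emeasure_mono sets.Un EUs BUs)
  also have "\<dots> \<le> emeasure ?G (\<Union>y\<in>?F. ?E (Suc m) n (u y)) + emeasure ?G (?B m s - ?U)"
    by (intro emeasure_subadditive EUs BUs)
  also have "\<dots> \<le> (\<Sum>y\<in>?F. emeasure ?G (?E (Suc m) n (u y)))"
    unfolding null add_0_right using Es by (intro emeasure_subadditive_finite fin) blast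
  also have "\<dots> \<le> (\<Sum>y\<in>?F. emeasure ?G (?B (Suc m) (u y)) *
      n_step_prob (next_position p rk) A n y)"
    using Suc.IH[of "Suc m" "u _"] by (intro sum_mono) (simp only: u_Suc)
  also have "\<dots> = emeasure ?G (?B m s) *
      (\<Sum>y\<in>?F. n_step_prob (next_position p rk) A n y * ennreal (pmf ?K y))"
    by (simp add: B_Suc sum_distrib_left mult_ac)
  also have "\<dots> = emeasure ?G (?B m s) * n_step_prob (next_position p rk) A (Suc n) (s m)"
    using fin by (simp add: nn_integral_measure_pmf_finite)
  finally show ?case .
qed

lemma emeasure_game_component_le:
  "emeasure (game p rk d) {\<omega>. \<omega> n \<in> A} \<le> n_step_prob (next_position p rk) A n (Playing d)"
proof -
  interpret prob_space "game p rk d" by (rule prob_space_game)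
  \<comment> \<open>The prefix bound will be applied with \<open>m = 0\<close>, since position 0 is
    almost surely \<open>Playing d\<close>.\<close>
  have start_1: "emeasure (game p rk d) {\<omega>. \<omega> 0 = Playing d} = 1"
    using emeasure_game[of p rk d 0 "\<lambda>_. Playing d"] by simp
  then have start: "AE \<omega> in game p rk d. \<omega> 0 = Playing d"
    using start_1 by (intro AE_I_eq_1) simp_all
  have "emeasure (game p rk d) {\<omega>. \<omega> n \<in> A} =
      emeasure (game p rk d) {\<omega>. (\<forall>i\<le>0. \<omega> i = Playing d) \<and> \<omega> (0 + n) \<in> A}"
  proof (rule emeasure_eq_AE)
    have "{\<omega>. (\<forall>i\<le>0. \<omega> i = Playing d) \<and> \<omega> (0 + n) \<in> A} =
        {\<omega>. \<omega> 0 = Playing d} \<inter> {\<omega>. \<omega> n \<in> A}" by auto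
    then show "{\<omega>. (\<forall>i\<le>0. \<omega> i = Playing d) \<and> \<omega> (0 + n) \<in> A} \<in> sets (game p rk d)"
      by (simp only:) (intro sets.Int sets_game_component)
  qed (use start in auto)
  also have "\<dots> \<le> emeasure (game p rk d) {\<omega>. \<forall>i\<le>0. \<omega> i = Playing d} *
      n_step_prob (next_position p rk) A n (Playing d)"
    by (rule emeasure_game_prefix_le)
  also have "\<dots> \<le> 1 * n_step_prob (next_position p rk) A n (Playing d)"
    by (simp add: start_1)
  finally show ?thesis by simp
qed

section \<open>The expected number of rounds\<close>

text \<open>Every index below \<open>num_rounds \<omega>\<close> contributes 1 to the sum, because
  the game is still going on there.\<close>

lemma ennreal_of_enat_num_rounds_le:
  "ennreal_of_enat (num_rounds \<omega>) \<le> (\<Sum>n. indicator {\<omega>. \<omega> n \<in> range Playing} \<omega>)"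
    (is "_ \<le> (\<Sum>n. ?f n)")
proof -
  have alive: "?f i = 1" if "enat i < num_rounds \<omega>" for i
  proof -
    have "\<omega> i \<noteq> Lost q" for q
    proof
      assume "\<omega> i = Lost q"
      then have "num_rounds \<omega> \<le> enat i"
        unfolding num_rounds_def by (intro INF_lower) auto
      with that show False by simp
    qed
    then show ?thesis by (cases "\<omega> i") auto
  qed
  \<comment> \<open>Finite truncations \<open>N\<close> serve both cases, the infinite value being
    their supremum.\<close>
  have le: "of_nat N \<le> (\<Sum>n. ?f n)" if "enat N \<le> num_rounds \<omega>" for N
  proof -
    have "(of_nat N :: ennreal) = (\<Sum>n<N. ?f n)"
      using that by (subst sum.cong[OF refl alive]) (auto intro: less_le_trans[of "enat _" "enat N"])
    also have "\<dots> \<le> (\<Sum>n. ?f n)"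
      by (rule sum_le_suminf) auto
    finally show ?thesis .
  qed
  show ?thesis
  proof (cases "num_rounds \<omega>")
    case (enat N)
    with le[of N] show ?thesis by simp
  next
    case infinity
    with le have "(SUP N. of_nat N :: ennreal) \<le> (\<Sum>n. ?f n)"
      by (intro SUP_least) simp
    then show ?thesis
      by (simp add: ennreal_SUP_of_nat_eq_top top_unique)
  qed
qed

theorem mainTheorem2:
  fixes p :: real and W :: "'c set" and rk :: "'c \<Rightarrow> rank" and d :: "'c decks"
  assumes "0 < p" "p < 1"
    and "finite W"
    and "deal W d"
  shows "(\<integral>\<^sup>+ \<omega>. ennreal_of_enat (num_rounds \<omega>) \<partial>game p rk d) < \<infinity>"
proof -
  let ?K = "next_position p rk" and ?A = "range Playing :: 'c position set"
  define D where "D = {d. deal W d}"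
  \<comment> \<open>The lost positions are included to make \<open>S\<close> closed under
    steps.\<close>
  define S where "S = Playing ` D \<union> range Lost"
  have "finite D"
    unfolding D_def by (rule finite_deals[OF \<open>finite W\<close>])
  then have "finite S"
    by (simp add: S_def UNIV_player)
  have absorbing: "?K s = return_pmf s" if "s \<notin> ?A" for s
    using that by (cases s) auto
  have S: "y \<in> S" if "s \<in> S" "y \<in> set_pmf (?K s)" for s y
  proof (cases y)
    case (Playing e)
    with that obtain d where "s = Playing d" "deal W d"
      by (auto simp: S_def D_def)
    with that Playing next_position_deal[of W d e p rk] show ?thesis
      by (auto simp: S_def D_def simp del: next_position.simps)
  qed (simp add: S_def)
  \<comment> \<open>The deals with almost sure survival for all time; if there were any, they would
    form a closed class.\<close>
  define C where "C = {d \<in> D. \<forall>n. n_step_prob ?K ?A n (Playing d) = 1}"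
  have "C = {}"
  proof (rule ccontr)
    assume "C \<noteq> {}"
    moreover have "finite C"
      using \<open>finite D\<close> by (simp add: C_def)
    moreover have "s \<in> Playing ` C" if "d \<in> C" "s \<in> set_pmf (?K (Playing d))" for d s
    proof -
      have one: "n_step_prob ?K ?A n s = 1" for n
        using that by (intro n_step_prob_eq_1_step[of _ _ n "Playing d"]) (auto simp: C_def
            simp del: next_position.simps n_step_prob.simps(2))
      \<comment> \<open>At time 0 the probability is the indicator of \<open>?A\<close>, so its
        being 1 excludes \<open>Lost\<close>.\<close>
      from one[of 0] obtain e where "s = Playing e"
        by (auto simp: indicator_def split: if_splits)
      with one S[of "Playing d" s] that show ?thesis
        by (auto simp: C_def S_def simp del: next_position.simps n_step_prob.simps)
    qed
    ultimately show False
      using no_closed_class_next_position[OF assms(1,2)] by blast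
  qed
  then have leave: "\<exists>n. n_step_prob ?K ?A n s < 1" if "s \<in> S \<inter> ?A" for s
    using that n_step_prob_le_1[of ?K ?A _ s] by (fastforce simp: C_def S_def less_le simp del: n_step_prob.simps)
  have "(\<integral>\<^sup>+ \<omega>. ennreal_of_enat (num_rounds \<omega>) \<partial>game p rk d) \<le>
      (\<integral>\<^sup>+ \<omega>. (\<Sum>n. indicator {\<omega>. \<omega> n \<in> ?A} \<omega>) \<partial>game p rk d)"
    by (intro nn_integral_mono ennreal_of_enat_num_rounds_le)
  \<comment> \<open>Exchanging sum and integral expresses the bound by the survival
    probabilities.\<close>
  also have "\<dots> = (\<Sum>n. emeasure (game p rk d) {\<omega>. \<omega> n \<in> ?A})"
    by (subst nn_integral_suminf) simp_all
  also have "\<dots> \<le> (\<Sum>n. n_step_prob ?K ?A n (Playing d))"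
    by (intro suminf_le emeasure_game_component_le) auto
  also have "\<dots> < \<infinity>"
    using \<open>finite S\<close> S absorbing leave \<open>deal W d\<close>
    by (intro n_step_prob_summable[of S]) (auto simp: S_def D_def)
  finally show ?thesis .
qed

end
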